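(* For every $n\ge1$ and every $k\ge0$, the number of permutations $\pi\in\mathcal S_n$ such that $\mathrm{Flatten}(\pi)$ has exactly $k$ descents equals the number of permutations $\sigma=\sigma_1\cdots\sigma_n\in\mathcal S_n$ (in one-line notation) having exactly $k$ big descents.
   Context: $\mathcal S_n$ is the set of permutations of $[n]$. For $\pi\in\mathcal S_n$ written in standard cycle form (each cycle begins with its smallest element, cycles ordered left to right by increasing smallest elements), $\mathrm{Flatten}(\pi)$ is the word obtained by erasing the parentheses. A descent of a word $w_1\cdots w_n$ is an index $i$ with $w_i>w_{i+1}$. A big descent of a permutation $\sigma_1\cdots\sigma_n$ in one-line notation is an index $i\in[n-1]$ with $\sigma_i-\sigma_{i+1}\ge2$. *)

theory Defs
  imports Main "HOL-Combinatorics.Cycles"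
begin

text \<open>
  A permutation of \<open>[n]\<close> is a function \<open>\<pi> :: nat \<Rightarrow> nat\<close> with \<open>\<pi> permutes {1..n}\<close>; its
  one-line notation is \<open>\<pi> 1, \<dots>, \<pi> n\<close>.

  The library list \<open>support \<pi> a\<close> is \<open>[a, \<pi> a, \<pi> (\<pi> a), \<dots>]\<close>, that is, the cycle of \<open>\<pi>\<close> through
  \<open>a\<close> written so that it begins with \<open>a\<close>. Despite the name it is \<open>[a]\<close>, not empty,
  if \<open>a\<close> is a fixed point, so that cycles of length 1 are kept below.
\<close>

definition standard_cycle_form :: "nat \<Rightarrow> (nat \<Rightarrow> nat) \<Rightarrow> nat list list" where
  "standard_cycle_form n \<pi> =
     map (support \<pi>) (filter (\<lambda>a. a = Min (set (support \<pi> a))) [1..<n + 1])"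

definition flatten :: "nat \<Rightarrow> (nat \<Rightarrow> nat) \<Rightarrow> nat list" where
  "flatten n \<pi> = concat (standard_cycle_form n \<pi>)"

text \<open>Positions in words are counted from 1, whereas \<open>(!)\<close> counts from 0.\<close>

definition descents :: "nat list \<Rightarrow> nat set" where
  "descents w = {i \<in> {1..<length w}. w ! (i - 1) > w ! i}"

definition big_descents :: "nat \<Rightarrow> (nat \<Rightarrow> nat) \<Rightarrow> nat set" where
  "big_descents n \<sigma> = {i \<in> {1..n - 1}. int (\<sigma> i) - int (\<sigma> (i + 1)) \<ge> 2}"

text \<open>
  The next lemmas confirm that \<open>standard_cycle_form\<close> lists the cycles of \<open>\<pi>\<close> as intended:
  each cycle begins with its smallest element, the cycles are ordered by these, and every
  element of \<open>[n]\<close> occurs exactly once.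
\<close>

lemma support_eq_Cons:
  assumes "permutation \<pi>"
  shows "hd (support \<pi> a) = a" "support \<pi> a \<noteq> []"
  using least_power_of_permutation(2)[OF assms, of a] by (simp_all add: hd_map)

lemma standard_cycle_form_cycle:
  assumes "\<pi> permutes {1..n}" "c \<in> set (standard_cycle_form n \<pi>)"
  shows "hd c = Min (set c)" "distinct c" "x \<in> set c \<Longrightarrow> cycle_of_list c x = \<pi> x"
proof -
  have p: "permutation \<pi>"
    using assms(1) permutation_permutes by blast
  obtain a where a: "c = support \<pi> a" "a = Min (set (support \<pi> a))"
    using assms(2) unfolding standard_cycle_form_def by auto
  show "hd c = Min (set c)"
    using a support_eq_Cons(1)[OF p, of a] by metis
  show "distinct c"
    using a(1) cycle_of_permutation[OF p] by blast
  show "x \<in> set c \<Longrightarrow> cycle_of_list c x = \<pi> x"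
    using a(1) cycle_restrict[OF p] by metis
qed

lemma standard_cycle_form_sorted:
  assumes "\<pi> permutes {1..n}"
  shows "sorted_wrt (<) (map hd (standard_cycle_form n \<pi>))"
proof -
  have p: "permutation \<pi>"
    using assms permutation_permutes by blast
  have "map hd (standard_cycle_form n \<pi>) = filter (\<lambda>a. a = Min (set (support \<pi> a))) [1..<n + 1]"
    unfolding standard_cycle_form_def map_map
    by (rule map_idI) (simp only: comp_apply support_eq_Cons(1)[OF p])
  then show ?thesis
    by (simp only: sorted_wrt_filter sorted_wrt_upt)
qed

lemma set_flatten:
  assumes "\<pi> permutes {1..n}"
  shows "set (flatten n \<pi>) = {1..n}"
proof -
  have p: "permutation \<pi>"
    using assms permutation_permutes by blast
  have self: "a \<in> set (support \<pi> a)" for a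
    using support_eq_Cons[OF p, of a] by (metis hd_in_set)
  have sub: "set (support \<pi> a) \<subseteq> {1..n}" if "a \<in> {1..n}" for a
    unfolding support_set[OF p]
    using permutes_in_funpow_image[OF assms that] by blast
  have "x \<in> set (flatten n \<pi>)" if x: "x \<in> {1..n}" for x
  proof -
    define m where "m = Min (set (support \<pi> x))"
    have m: "m \<in> set (support \<pi> x)"
      unfolding m_def using self[of x] Min_in[of "set (support \<pi> x)"] by (metis List.finite_set empty_iff)
    then have "set (support \<pi> m) \<inter> set (support \<pi> x) \<noteq> {}"
      using self by blast
    then have eq: "set (support \<pi> m) = set (support \<pi> x)"
      using disjoint_support[OF p] by (meson UNIV_I disjoint_def image_iff)
    have "m \<in> {1..n}"
      using m sub[OF x] by blast
    moreover have "m = Min (set (support \<pi> m))"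
      unfolding eq by (rule m_def)
    ultimately have "support \<pi> m \<in> set (standard_cycle_form n \<pi>)"
      unfolding standard_cycle_form_def set_map set_filter by (intro imageI) auto
    moreover have "x \<in> set (support \<pi> m)"
      unfolding eq by (rule self)
    ultimately show ?thesis
      unfolding flatten_def set_concat by blast
  qed
  moreover have "set (flatten n \<pi>) \<subseteq> {1..n}"
  proof
    fix x assume "x \<in> set (flatten n \<pi>)"
    then obtain c where c: "c \<in> set (standard_cycle_form n \<pi>)" "x \<in> set c"
      unfolding flatten_def by auto
    from c(1) obtain a where "c = support \<pi> a" "a \<in> {1..n}"
      unfolding standard_cycle_form_def by auto
    with c(2) have "a \<in> {1..n}" "x \<in> set (support \<pi> a)"
      by blast+
    then show "x \<in> {1..n}"
      using sub[of a] by (rule_tac subsetD)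
  qed
  ultimately show ?thesis by blast
qed

lemma distinct_flatten:
  assumes "\<pi> permutes {1..n}"
  shows "distinct (flatten n \<pi>)"
proof -
  have p: "permutation \<pi>"
    using assms permutation_permutes by blast
  have "distinct (map hd (standard_cycle_form n \<pi>))"
    using standard_cycle_form_sorted[OF assms] strict_sorted_iff by blast
  then have d: "distinct (standard_cycle_form n \<pi>)"
    unfolding distinct_map by blast
  have "set c \<inter> set c' = {}"
    if c: "c \<in> set (standard_cycle_form n \<pi>)" "c' \<in> set (standard_cycle_form n \<pi>)" "c \<noteq> c'" for c c'
  proof (rule ccontr)
    obtain a b where ab: "c = support \<pi> a" "a = Min (set c)" "c' = support \<pi> b" "b = Min (set c')"
      using c(1,2) unfolding standard_cycle_form_def by auto
    assume "set c \<inter> set c' \<noteq> {}"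
    then have "set c = set c'"
      using disjoint_support[OF p] ab(1,3) by (meson UNIV_I disjoint_def image_iff)
    then show False
      using ab c(3) by metis
  qed
  then show ?thesis
    unfolding flatten_def
    using d standard_cycle_form_cycle(2)[OF assms] by (intro distinct_concat) auto
qed

end

theory Submission
  imports Defs
begin

text \<open>
  Every permutation of \<open>[n + 1]\<close> arises from a unique permutation of \<open>[n]\<close> by inserting \<open>n + 1\<close> in
  one of \<open>n + 1\<close> ways. On the cycle side, \<open>n + 1\<close> is placed right after some \<open>j\<close> in its cycle, hence
  right after \<open>j\<close> in the flattened word, or it becomes a new last cycle; the number of descents is
  kept exactly by the slots in a descent and by the two ways to put \<open>n + 1\<close> at the end. In one-line
  notation, the number of big descents is kept exactly by the slots in a big descent, the slot
  before \<open>n\<close> and the end slot. In both cases \<open>s + 2\<close> of the \<open>n + 1\<close> insertions keep the value \<open>s\<close> of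
  the statistic and the others raise it by one, so the two distributions obey the same recursion.
  Summing an arbitrary test function of the statistic avoids handling the two terms of
  this recursion separately.
\<close>

section \<open>Inserting a letter into a word and counting related neighbours\<close>

text \<open>Common form of both statistics, with \<open>(>)\<close> or \<open>big_drop\<close> for
  \<open>R\<close>. Counting from 1 makes \<open>i\<close> also the number of letters before the
  pair's gap, so inserting at slot \<open>i\<close> breaks exactly the pair at
  \<open>i\<close>.\<close>

definition adjacencies :: "('a \<Rightarrow> 'a \<Rightarrow> bool) \<Rightarrow> 'a list \<Rightarrow> nat set" where
  "adjacencies R w = {i \<in> {1..<length w}. R (w ! (i - 1)) (w ! i)}"

lemma finite_adjacencies [simp]: "finite (adjacencies R w)"
  unfolding adjacencies_def by simp

text \<open>The insertion breaks the pair at \<open>i\<close> and creates two pairs: the one ending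
  in \<open>x\<close> never counts by \<open>top\<close>, and the one starting with \<open>x\<close>
  makes up for a lost adjacency by \<open>adj\<close>. Hence the count never drops.\<close>

lemma card_adjacencies_insert:
  assumes i: "i \<le> length w"
    and top: "\<And>u. u \<in> set w \<Longrightarrow> \<not> R u x"
    and adj: "i \<in> adjacencies R w \<Longrightarrow> R x (w ! i)"
  shows "card (adjacencies R (take i w @ x # drop i w)) =
    card (adjacencies R w) + (if i < length w \<and> R x (w ! i) \<and> i \<notin> adjacencies R w then 1 else 0)"
proof -
  let ?v = "take i w @ x # drop i w"
  \<comment> \<open>\<open>A\<close>, \<open>D\<close>, \<open>B\<close> are the old adjacencies
    before, at and after the slot. Those in \<open>B\<close> move one place to the right, and
    \<open>C\<close> holds the possible new adjacency from \<open>x\<close> to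
    \<open>w ! i\<close>.\<close>
  define A where "A = {p \<in> adjacencies R w. p < i}"
  define B where "B = {p \<in> adjacencies R w. i < p}"
  define C where "C = (if i < length w \<and> R x (w ! i) then {Suc i} else {})"
  define D where "D = adjacencies R w \<inter> {i}"
  have fin: "finite A" "finite B" "finite C" "finite D"
    unfolding A_def B_def C_def D_def by auto
  have w: "adjacencies R w = A \<union> D \<union> B"
    unfolding A_def B_def D_def by auto
  have cw: "card (adjacencies R w) = card A + card D + card B"
  proof -
    have "A \<inter> D = {}" "(A \<union> D) \<inter> B = {}" unfolding A_def B_def D_def by auto
    then show ?thesis unfolding w using fin by (simp only: card_Un_disjoint finite_Un)
  qed
  have len: "length ?v = Suc (length w)" using i by simp
  have nth: "?v ! q = (if q < i then w ! q else if q = i then x else w ! (q - 1))" for q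
  proof -
    consider "q < i" | "q = i" | r where "q = Suc (i + r)"
      by (metis less_imp_Suc_add linorder_neqE_nat)
    then show ?thesis
      by cases (use i in \<open>simp_all add: nth_append\<close>)
  qed
  have mem: "p \<in> adjacencies R ?v \<longleftrightarrow> 1 \<le> p \<and> p \<le> length w \<and> R (?v ! (p - 1)) (?v ! p)" for p
    unfolding adjacencies_def len by auto
  have v: "adjacencies R ?v = A \<union> C \<union> Suc ` B"
  proof (rule set_eqI)
    fix p
    consider "p < i" | "p = i" | "p = Suc i" | "Suc i < p" by linarith
    then show "p \<in> adjacencies R ?v \<longleftrightarrow> p \<in> A \<union> C \<union> Suc ` B"
    proof cases
      case 1
      then show ?thesis unfolding mem nth using i
        by (auto simp: adjacencies_def A_def B_def C_def)
    next
      case 2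
      have "\<not> R (w ! (i - 1)) x" if "1 \<le> i" using that i by (intro top nth_mem) simp
      then show ?thesis unfolding mem nth using 2
        by (auto simp: A_def B_def C_def)
    next
      case 3
      then show ?thesis unfolding mem nth
        by (auto simp: A_def B_def C_def)
    next
      case 4
      then obtain q where "p = Suc q" "i < q" by (cases p) auto
      then show ?thesis unfolding mem nth
        by (auto simp: adjacencies_def A_def B_def C_def)
    qed
  qed
  have "card (adjacencies R ?v) = card A + card C + card (Suc ` B)"
  proof -
    have "A \<inter> C = {}" "(A \<union> C) \<inter> Suc ` B = {}" unfolding A_def B_def C_def by auto
    then show ?thesis unfolding v using fin by (simp only: card_Un_disjoint finite_Un finite_imageI)
  qed
  also have "card (Suc ` B) = card B" by (simp add: card_image)
  finally have cv: "card (adjacencies R ?v) = card A + card C + card B" .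
  have "card C = card D + (if i < length w \<and> R x (w ! i) \<and> i \<notin> adjacencies R w then 1 else 0)"
  proof (cases "i \<in> adjacencies R w")
    case True
    then have "i < length w" unfolding adjacencies_def by simp
    with True adj show ?thesis unfolding C_def D_def by simp
  next
    case False
    then show ?thesis unfolding C_def D_def by simp
  qed
  then show ?thesis using cw cv by simp
qed

lemma sum_if_mem:
  fixes a b :: nat
  assumes "finite I" "S \<subseteq> I"
  shows "(\<Sum>i\<in>I. if i \<in> S then a else b) = card S * a + (card I - card S) * b"
proof -
  have "I \<inter> {i. i \<in> S} = S" "I \<inter> - {i. i \<in> S} = I - S" using assms(2) by auto
  then show ?thesis
    using assms by (simp add: sum.If_cases card_Diff_subset finite_subset)
qed

text \<open>The total of \<open>f\<close> over the \<open>n + 1\<close> insertions into an object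
  with statistic \<open>s\<close>: the factor \<open>n - (s + 1)\<close> is
  \<open>(n + 1) - (s + 2)\<close>, the number of insertions that raise it.\<close>

definition insertion_step :: "nat \<Rightarrow> (nat \<Rightarrow> nat) \<Rightarrow> nat \<Rightarrow> nat" where
  "insertion_step n f s = (s + 2) * f s + (n - (s + 1)) * f (s + 1)"

section \<open>Insertion behind a given letter\<close>

text \<open>The place is given by a letter, not by a position, so that the operation commutes with
  \<open>concat\<close> and can be applied to each cycle separately.\<close>

definition insert_after :: "'a \<Rightarrow> 'a \<Rightarrow> 'a list \<Rightarrow> 'a list" where
  "insert_after x j xs = concat (map (\<lambda>y. if y = j then [y, x] else [y]) xs)"

lemma insert_after_append [simp]:
  "insert_after x j (us @ vs) = insert_after x j us @ insert_after x j vs"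
  by (simp add: insert_after_def)

lemma insert_after_notin: "j \<notin> set xs \<Longrightarrow> insert_after x j xs = xs"
  by (induction xs) (auto simp: insert_after_def)

lemma insert_after_split:
  assumes "j \<notin> set us" "j \<notin> set vs"
  shows "insert_after x j (us @ j # vs) = us @ j # x # vs"
  using insert_after_notin[OF assms(1), of x] insert_after_notin[OF assms(2), of x]
  by (simp add: insert_after_def)

lemma insert_after_concat:
  "insert_after x j (concat xss) = concat (map (insert_after x j) xss)"
  by (induction xss) (simp_all, simp add: insert_after_def)

text \<open>Turns insertion by letter into insertion at a slot, the form that
  \<open>card_adjacencies_insert\<close> handles.\<close>

lemma insert_after_nth:
  assumes "distinct w" "i < length w"
  shows "insert_after x (w ! i) w = take (Suc i) w @ x # drop (Suc i) w"
proof -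
  have w: "w = take i w @ w ! i # drop (Suc i) w"
    using assms(2) by (rule id_take_nth_drop)
  have d: "distinct (take i w @ w ! i # drop (Suc i) w)" using assms(1) w by simp
  have "insert_after x (w ! i) w = insert_after x (w ! i) (take i w @ w ! i # drop (Suc i) w)"
    using w by simp
  also have "\<dots> = take i w @ w ! i # x # drop (Suc i) w"
    using d by (intro insert_after_split) auto
  finally show ?thesis using assms(2) by (simp add: take_Suc_conv_app_nth)
qed

section \<open>Cycles and the insertion of a new element\<close>

text \<open>Walking along the list computes the iterates of \<open>p\<close> at its head;
  distinctness rules out a return to the head before the end, so the least power is the
  length.\<close>

lemma support_eqI:
  assumes "distinct xs" "xs \<noteq> []" "successively (\<lambda>u v. p u = v) (xs @ [hd xs])"
  shows "support p (hd xs) = xs"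
proof -
  let ?l = "length xs"
  have iter: "(p ^^ i) (hd xs) = (xs @ [hd xs]) ! i" if "i \<le> ?l" for i
    using that
  proof (induction i)
    case 0
    then show ?case using assms(2) by (simp add: nth_append hd_conv_nth)
  next
    case (Suc i)
    then show ?case using assms(3) by (simp add: successively_conv_nth)
  qed
  have "least_power p (hd xs) = ?l"
    unfolding least_power_def
  proof (rule Least_equality)
    show "(p ^^ ?l) (hd xs) = hd xs \<and> 0 < ?l" using iter[of ?l] assms(2) by simp
  next
    fix m assume m: "(p ^^ m) (hd xs) = hd xs \<and> 0 < m"
    show "?l \<le> m"
    proof (rule ccontr)
      assume "\<not> ?l \<le> m"
      then have "xs ! m = xs ! 0" using iter[of m] m assms(2) by (simp add: nth_append hd_conv_nth)
      then show False using \<open>\<not> ?l \<le> m\<close> m assms(1,2) nth_eq_iff_index_eq[of xs m 0] by auto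
    qed
  qed
  then show ?thesis using iter by (intro nth_equalityI) (auto simp: nth_append)
qed

lemma successively_support:
  assumes "permutation p"
  shows "successively (\<lambda>u v. p u = v) (support p a @ [a])"
proof -
  have "(p ^^ least_power p a) a = a" by (rule least_power_of_permutation(1)[OF assms])
  then have "support p a @ [a] = map (\<lambda>i. (p ^^ i) a) [0..<Suc (least_power p a)]" by simp
  then show ?thesis by (simp add: successively_conv_nth del: upt_Suc)
qed

text \<open>Composing with the transposition replaces the arrow from \<open>j\<close> to
  \<open>p j\<close> by arrows from \<open>j\<close> to \<open>x\<close> and from \<open>x\<close>
  to \<open>p j\<close>; all other arrows between points different from \<open>x\<close>
  stay.\<close>

lemma support_transpose:
  assumes p: "permutation p" and x: "p x = x" "x \<noteq> j" "a \<noteq> x"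
  shows "support (p \<circ> transpose x j) a = insert_after x j (support p a)"
proof -
  let ?q = "p \<circ> transpose x j" and ?s = "support p a"
  have d: "distinct ?s" using cycle_of_permutation[OF p] by blast
  have hd: "hd ?s = a" and ne: "?s \<noteq> []" using support_eq_Cons[OF p] by blast+
  have succ: "successively (\<lambda>u v. p u = v) (?s @ [a])" by (rule successively_support[OF p])
  \<comment> \<open>If \<open>x\<close> were an iterate of \<open>a\<close>, the same power of
    \<open>p\<close> would send both \<open>a\<close> and the fixed point \<open>x\<close> to
    \<open>x\<close>, against injectivity.\<close>
  have xn: "x \<notin> set ?s"
  proof
    assume "x \<in> set ?s"
    then obtain i where i: "x = (p ^^ i) a" by auto
    have "(p ^^ i) x = x" using x(1) by (induction i) auto
    moreover have "inj (p ^^ i)" using p by (simp add: bij_is_inj bij_fn permutation_bijective)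
    ultimately show False using i x(3) by (metis injD)
  qed
  show ?thesis
  proof (cases "j \<in> set ?s")
    case False
    have "successively (\<lambda>u v. ?q u = v) (?s @ [a])
        \<longleftrightarrow> successively (\<lambda>u v. p u = v) (?s @ [a])"
    proof (rule successively_cong[OF _ refl])
      fix u v assume "u \<in> set (?s @ [a])"
      then have "u \<in> set ?s" using hd hd_in_set[OF ne] by (auto simp del: set_map)
      then have "u \<noteq> x" "u \<noteq> j" using xn False by blast+
      then show "?q u = v \<longleftrightarrow> p u = v" by (simp add: transpose_def)
    qed
    then have "support ?q (hd ?s) = ?s"
      using succ d hd by (intro support_eqI[OF d ne]) simp
    then show ?thesis using False by (simp add: hd insert_after_notin)
  next
    case True
    then obtain us vs where s: "?s = us @ j # vs" by (meson split_list)
    let ?t = "us @ j # x # vs"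
    have out: "j \<notin> set us" "j \<notin> set vs" "x \<notin> set us" "x \<notin> set vs"
      using d xn unfolding s by auto
    have ins: "insert_after x j ?s = ?t"
      unfolding s by (rule insert_after_split[OF out(1,2)])
    have ha: "hd ?t = a" using hd unfolding s by (cases us) auto
    \<comment> \<open>The closed walk is cut at \<open>j\<close>. The term
      \<open>hd (vs @ [a])\<close> also covers empty \<open>vs\<close>, where \<open>j\<close> is
      followed by the return to \<open>a\<close>.\<close>
    have sc: "successively (\<lambda>u v. p u = v) us" "us \<noteq> [] \<Longrightarrow> p (last us) = j"
        "p j = hd (vs @ [a])" "successively (\<lambda>u v. p u = v) vs" "vs \<noteq> [] \<Longrightarrow> p (last vs) = a"
      using succ unfolding s by (auto simp: successively_append_iff successively_Cons)
    have "successively (\<lambda>u v. ?q u = v) us" "successively (\<lambda>u v. ?q u = v) vs"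
      using out by (auto intro!: successively_mono[OF sc(1)] successively_mono[OF sc(4)] simp: transpose_def)
    moreover have "us \<noteq> [] \<Longrightarrow> ?q (last us) = j" "vs \<noteq> [] \<Longrightarrow> ?q (last vs) = a"
      using sc(2,5) out last_in_set[of us] last_in_set[of vs] by (auto simp: transpose_def)
    moreover have "?q j = x" "?q x = hd (vs @ [a])" using x(1) sc(3) by simp_all
    ultimately have "successively (\<lambda>u v. ?q u = v) (?t @ [hd ?t])"
      unfolding ha by (auto simp: successively_append_iff successively_Cons)
    moreover have "distinct ?t" using d xn out unfolding s by auto
    ultimately have "support ?q (hd ?t) = ?t" by (intro support_eqI) auto
    then show ?thesis unfolding ha ins .
  qed
qed

section \<open>Flattened words under insertion of the largest element\<close>

lemma flatten_Suc_fixed: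
  assumes "\<pi> permutes {1..n}"
  shows "flatten (Suc n) \<pi> = flatten n \<pi> @ [Suc n]"
proof -
  have "\<pi> (Suc n) = Suc n" using assms by (simp add: permutes_def)
  then have "support \<pi> (Suc n) = [Suc n]" using support_eqI[of "[Suc n]" \<pi>] by simp
  then show ?thesis
    unfolding flatten_def standard_cycle_form_def
    by (simp del: set_map map_eq_Cons_conv)
qed

text \<open>The new element exceeds all others, so no old cycle changes its minimum: the cycles keep
  their first entries and their order, and only the cycle through \<open>j\<close> gains a
  letter.\<close>

lemma flatten_Suc_transpose:
  assumes p: "\<pi> permutes {1..n}" and j: "j \<in> {1..n}"
  shows "flatten (Suc n) (\<pi> \<circ> transpose (Suc n) j) = insert_after (Suc n) j (flatten n \<pi>)"
proof -
  let ?q = "\<pi> \<circ> transpose (Suc n) j"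
  have perm: "permutation \<pi>" using p permutation_permutes by blast
  have fixed: "\<pi> (Suc n) = Suc n" using p by (simp add: permutes_def)
  have sub: "set (support \<pi> a) \<subseteq> {1..n}" if "a \<in> {1..n}" for a
    unfolding support_set[OF perm] using permutes_in_funpow_image[OF p that] by blast
  have sup: "support ?q a = insert_after (Suc n) j (support \<pi> a)" if "a \<in> {1..n}" for a
    using support_transpose[OF perm fixed, of j a] that j by simp
  have minimum: "Min (set (support ?q a)) = Min (set (support \<pi> a))" if a: "a \<in> {1..n}" for a
  proof -
    let ?S = "set (support \<pi> a)"
    have ne: "?S \<noteq> {}" using support_eq_Cons(2)[OF perm, of a] by (metis set_empty)
    have "set (support ?q a) = (if j \<in> ?S then insert (Suc n) ?S else ?S)"
      unfolding sup[OF a] insert_after_def by auto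
    moreover have "Min (insert (Suc n) ?S) = Min ?S"
    proof -
      have "Min ?S \<in> {1..n}" using sub[OF a] Min_in[OF _ ne] by blast
      then show ?thesis unfolding Min_insert[OF List.finite_set ne] by (intro min_absorb2) simp
    qed
    ultimately show ?thesis by simp
  qed
  \<comment> \<open>\<open>Suc n\<close> starts no cycle of \<open>?q\<close>, because its cycle
    contains its image \<open>\<pi> j\<close>, which is smaller.\<close>
  have "Min (set (support ?q (Suc n))) \<noteq> Suc n"
  proof -
    have q: "permutation ?q"
      using perm by (intro permutation_compose permutation_swap_id)
    have "?q (Suc n) \<in> set (support ?q (Suc n))"
      unfolding support_set[OF q] by (rule range_eqI[of _ _ 1]) simp
    then have "Min (set (support ?q (Suc n))) \<le> ?q (Suc n)" by (intro Min_le) auto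
    moreover have "?q (Suc n) \<in> {1..n}" using permutes_in_image[OF p] j by simp
    ultimately show ?thesis by auto
  qed
  then have "standard_cycle_form (Suc n) ?q =
      map (support ?q) (filter (\<lambda>a. a = Min (set (support ?q a))) [1..<n + 1])"
    unfolding standard_cycle_form_def by (simp del: o_apply)
  also have "filter (\<lambda>a. a = Min (set (support ?q a))) [1..<n + 1] =
      filter (\<lambda>a. a = Min (set (support \<pi> a))) [1..<n + 1]"
    by (rule filter_cong[OF refl]) (use minimum in force)
  also have "map (support ?q) \<dots> =
      map (insert_after (Suc n) j \<circ> support \<pi>) (filter (\<lambda>a. a = Min (set (support \<pi> a))) [1..<n + 1])"
    by (rule map_cong[OF refl]) (use sup in force)
  finally show ?thesis
    unfolding flatten_def standard_cycle_form_def insert_after_concat map_map by simp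
qed

section \<open>The recursion for descents of flattened words\<close>

lemma descents_eq_adjacencies: "descents = adjacencies (>)"
  by (auto simp: fun_eq_iff descents_def adjacencies_def)

text \<open>For \<open>j \<le> n\<close> the new letter runs through the slots \<open>1\<close> to
  \<open>n\<close>, slot \<open>0\<close> being excluded; the descents and the end slot
  \<open>n\<close> keep the statistic. The choice \<open>j = Suc n\<close> is a second way to reach
  the end, which gives \<open>s + 2\<close> in total.\<close>

lemma sum_descents_flatten_insert:
  assumes p: "\<pi> permutes {1..n}" and n: "n \<ge> 1"
  shows "(\<Sum>j\<in>{1..Suc n}. f (card (descents (flatten (Suc n) (\<pi> \<circ> transpose (Suc n) j))))) =
    insertion_step n f (card (descents (flatten n \<pi>)))"
proof -
  let ?w = "flatten n \<pi>"
  let ?D = "adjacencies (>) ?w"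
  let ?d = "card ?D"
  let ?h = "\<lambda>j. f (card (descents (flatten (Suc n) (\<pi> \<circ> transpose (Suc n) j))))"
  let ?g = "\<lambda>i. f (card (adjacencies (>) (take i ?w @ Suc n # drop i ?w)))"
  have set: "set ?w = {1..n}" and dist: "distinct ?w"
    using set_flatten[OF p] distinct_flatten[OF p] by auto
  have len: "length ?w = n" using distinct_card[OF dist] set by simp
  have big: "u < Suc n" if "u \<in> set ?w" for u using that set by auto
  have g: "?g i = (if i \<in> insert n ?D then f ?d else f (?d + 1))" if "i \<le> n" for i
  proof -
    have "Suc n > ?w ! i" if "i \<in> ?D"
      using that len by (intro big nth_mem) (simp add: adjacencies_def)
    then have "card (adjacencies (>) (take i ?w @ Suc n # drop i ?w)) =
        ?d + (if i < length ?w \<and> Suc n > ?w ! i \<and> i \<notin> ?D then 1 else 0)"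
      by (intro card_adjacencies_insert) (simp_all add: that len less_imp_not_less[OF big])
    then show ?thesis using that len big[of "?w ! i"] by simp
  qed
  have "(\<Sum>j\<in>{1..n}. ?h j) =
      (\<Sum>j\<in>{1..n}. f (card (adjacencies (>) (insert_after (Suc n) j ?w))))"
    by (intro sum.cong refl) (simp only: flatten_Suc_transpose[OF p] descents_eq_adjacencies)
  \<comment> \<open>The letters \<open>j\<close> are reindexed by their positions in the flattened
    word.\<close>
  also have "\<dots> = (\<Sum>i<n. f (card (adjacencies (>) (insert_after (Suc n) (?w ! i) ?w))))"
    using bij_betw_nth[OF dist, of "{..<n}" "{1..n}"] set len
    by (intro sum.reindex_bij_betw[symmetric]) auto
  also have "\<dots> = (\<Sum>i<n. ?g (Suc i))"
    using len by (intro sum.cong refl) (simp add: insert_after_nth[OF dist])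
  also have "\<dots> = (\<Sum>i\<in>{1..n}. ?g i)"
    using sum.shift_bounds_Suc_ivl[of ?g 0 n] by (simp add: atLeast0LessThan atLeastLessThanSuc_atLeastAtMost)
  also have "\<dots> = (\<Sum>i\<in>{1..n}. if i \<in> insert n ?D then f ?d else f (?d + 1))"
    using g by (intro sum.cong) auto
  also have "\<dots> = card (insert n ?D) * f ?d + (card {1..n} - card (insert n ?D)) * f (?d + 1)"
    using n len by (intro sum_if_mem) (auto simp: adjacencies_def)
  also have "card (insert n ?D) = ?d + 1"
    using len by (subst card_insert_disjoint) (auto simp: adjacencies_def)
  finally have "(\<Sum>j\<in>{1..n}. ?h j) =
      (?d + 1) * f ?d + (n - (?d + 1)) * f (?d + 1)" by (simp only: card_atLeastAtMost diff_Suc_1)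
  \<comment> \<open>Here the transposition is the identity, so \<open>Suc n\<close> is a fixed point
    and its singleton cycle comes last.\<close>
  moreover have "card (descents (flatten (Suc n) (\<pi> \<circ> transpose (Suc n) (Suc n)))) = ?d"
  proof -
    have "take n ?w @ Suc n # drop n ?w = flatten (Suc n) (\<pi> \<circ> transpose (Suc n) (Suc n))"
      using len flatten_Suc_fixed[OF p] by simp
    moreover have "card (adjacencies (>) (take n ?w @ Suc n # drop n ?w)) = ?d"
      by (subst card_adjacencies_insert) (simp_all add: len less_imp_not_less[OF big] adjacencies_def)
    ultimately show ?thesis by (simp add: descents_eq_adjacencies)
  qed
  ultimately have "(\<Sum>j\<in>{1..n}. ?h j) + ?h (Suc n) = insertion_step n f ?d"
    unfolding insertion_step_def by (simp only: add_mult_distrib mult_1 mult_2)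
  then show ?thesis
    unfolding descents_eq_adjacencies by (simp only: sum.cl_ivl_Suc) (use n in simp)
qed

text \<open>The known decomposition has the transposition on the left, whereas insertion after
  \<open>j\<close> composes on the right. As \<open>q\<close> fixes \<open>a\<close>, conjugation by
  \<open>q\<close> turns \<open>transpose a b\<close> into \<open>transpose a (q b)\<close>, and
  \<open>b\<close> is reindexed by \<open>q\<close>.\<close>

lemma sum_permutes_insert_right:
  assumes "finite S" "a \<notin> S"
  shows "(\<Sum>p | p permutes insert a S. F p) =
    (\<Sum>q | q permutes S. \<Sum>b\<in>insert a S. F (q \<circ> transpose a b))"
proof -
  have "(\<Sum>p | p permutes insert a S. F p) =
      (\<Sum>b\<in>insert a S. \<Sum>q | q permutes S. F (transpose a b \<circ> q))"
    by (rule sum_over_permutations_insert[OF assms])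
  also have "\<dots> = (\<Sum>q | q permutes S. \<Sum>b\<in>insert a S. F (transpose a b \<circ> q))"
    by (rule sum.swap)
  also have "\<dots> = (\<Sum>q | q permutes S. \<Sum>b\<in>insert a S. F (q \<circ> transpose a b))"
  proof (rule sum.cong[OF refl])
    fix q assume "q \<in> {q. q permutes S}"
    then have q: "q permutes S" by simp
    have qa: "q a = a" using q assms(2) by (simp add: permutes_def)
    have "bij_betw q (insert a S) (insert a S)"
      using permutes_imp_permutes_insert[OF q] by (rule permutes_imp_bij)
    then have "(\<Sum>b\<in>insert a S. F (transpose a b \<circ> q)) = (\<Sum>b\<in>insert a S. F (transpose a (q b) \<circ> q))"
      by (rule sum.reindex_bij_betw[symmetric])
    also have "\<dots> = (\<Sum>b\<in>insert a S. F (q \<circ> transpose a b))"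
    proof -
      have "transpose a (q b) \<circ> q = q \<circ> transpose a b" for b
        using permutes_inj[OF q] qa by (auto simp: fun_eq_iff transpose_def inj_eq)
      then show ?thesis by simp
    qed
    finally show "(\<Sum>b\<in>insert a S. F (transpose a b \<circ> q)) = (\<Sum>b\<in>insert a S. F (q \<circ> transpose a b))" .
  qed
  finally show ?thesis .
qed

lemma sum_descents_flatten_Suc:
  assumes n: "n \<ge> 1"
  shows "(\<Sum>\<pi> | \<pi> permutes {1..Suc n}. f (card (descents (flatten (Suc n) \<pi>)))) =
    (\<Sum>\<pi> | \<pi> permutes {1..n}. insertion_step n f (card (descents (flatten n \<pi>))))"
proof -
  have ins: "{1..Suc n} = insert (Suc n) {1..n}" by auto
  have "(\<Sum>\<pi> | \<pi> permutes {1..Suc n}. f (card (descents (flatten (Suc n) \<pi>)))) =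
      (\<Sum>\<pi> | \<pi> permutes {1..n}. \<Sum>j\<in>{1..Suc n}.
        f (card (descents (flatten (Suc n) (\<pi> \<circ> transpose (Suc n) j)))))"
    unfolding ins by (rule sum_permutes_insert_right) auto
  also have "\<dots> = (\<Sum>\<pi> | \<pi> permutes {1..n}. insertion_step n f (card (descents (flatten n \<pi>))))"
    using n by (intro sum.cong refl sum_descents_flatten_insert) auto
  finally show ?thesis .
qed

section \<open>One-line words of permutations\<close>

definition words :: "nat \<Rightarrow> nat list set" where
  "words n = {w. distinct w \<and> set w = {1..n}}"

lemma length_words: "w \<in> words n \<Longrightarrow> length w = n"
  using distinct_card[of w] by (simp add: words_def)

lemma bij_betw_one_line:
  "bij_betw (\<lambda>\<sigma>. map \<sigma> [1..<n + 1]) {\<sigma>. \<sigma> permutes {1..n}} (words n)"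
proof (rule bij_betw_imageI)
  show "inj_on (\<lambda>\<sigma>. map \<sigma> [1..<n + 1]) {\<sigma>. \<sigma> permutes {1..n}}"
  proof (rule inj_onI, rule ext)
    fix \<sigma> \<tau> x
    assume "\<sigma> \<in> {\<sigma>. \<sigma> permutes {1..n}}" "\<tau> \<in> {\<sigma>. \<sigma> permutes {1..n}}"
      and eq: "map \<sigma> [1..<n + 1] = map \<tau> [1..<n + 1]"
    then have p: "\<sigma> permutes {1..n}" "\<tau> permutes {1..n}" by auto
    show "\<sigma> x = \<tau> x"
    proof (cases "x \<in> {1..n}")
      case True
      then show ?thesis using eq by (simp only: map_eq_conv set_upt) auto
    next
      case False
      then show ?thesis using p by (simp add: permutes_def)
    qed
  qed
  show "(\<lambda>\<sigma>. map \<sigma> [1..<n + 1]) ` {\<sigma>. \<sigma> permutes {1..n}} = words n"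
  proof (intro equalityI subsetI)
    fix w assume "w \<in> (\<lambda>\<sigma>. map \<sigma> [1..<n + 1]) ` {\<sigma>. \<sigma> permutes {1..n}}"
    then obtain \<sigma> where "\<sigma> permutes {1..n}" "w = map \<sigma> [1..<n + 1]" by auto
    then show "w \<in> words n"
      unfolding words_def using permutes_image[of \<sigma> "{1..n}"] permutes_inj_on[of \<sigma> "{1..n}"]
      by (auto simp: distinct_map atLeastLessThanSuc_atLeastAtMost simp del: upt_Suc)
  next
    fix w assume w: "w \<in> words n"
    \<comment> \<open>The shift \<open>i - 1\<close> reconciles positions from 1 with list indices
      from 0; outside \<open>{1..n}\<close> the identity is required by
      \<open>permutes\<close>.\<close>
    define \<sigma> where "\<sigma> = (\<lambda>i. if i \<in> {1..n} then w ! (i - 1) else i)"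
    have one: "map \<sigma> [1..<n + 1] = w"
      using length_words[OF w] by (intro nth_equalityI) (simp_all add: \<sigma>_def del: upt_Suc)
    have "bij_betw \<sigma> {1..n} {1..n}"
    proof (rule bij_betw_imageI)
      have "distinct (map \<sigma> [1..<n + 1])" "set (map \<sigma> [1..<n + 1]) = {1..n}"
        using w unfolding one words_def by auto
      then show "inj_on \<sigma> {1..n}" "\<sigma> ` {1..n} = {1..n}"
        by (simp_all add: distinct_map atLeastLessThanSuc_atLeastAtMost del: upt_Suc)
    qed
    then have "\<sigma> permutes {1..n}" by (rule bij_imp_permutes) (auto simp: \<sigma>_def)
    then show "w \<in> (\<lambda>\<sigma>. map \<sigma> [1..<n + 1]) ` {\<sigma>. \<sigma> permutes {1..n}}"
      using one by (intro image_eqI[of _ _ \<sigma>]) auto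
  qed
qed

text \<open>\<open>Suc n\<close> occurs exactly once in a word of \<open>words (Suc n)\<close>:
  deleting it recovers \<open>w\<close>, and its place recovers the slot.\<close>

lemma bij_betw_insert_words:
  "bij_betw (\<lambda>(w, i). take i w @ Suc n # drop i w) (words n \<times> {..n}) (words (Suc n))"
proof (rule bij_betw_imageI)
  show "inj_on (\<lambda>(w, i). take i w @ Suc n # drop i w) (words n \<times> {..n})"
  proof (rule inj_onI)
    fix P P'
    assume "P \<in> words n \<times> {..n}" "P' \<in> words n \<times> {..n}"
      and "(\<lambda>(w, i). take i w @ Suc n # drop i w) P = (\<lambda>(w, i). take i w @ Suc n # drop i w) P'"
    then obtain w i w' i' where P: "P = (w, i)" "P' = (w', i')"
      and w: "w \<in> words n" "i \<in> {..n}" "w' \<in> words n" "i' \<in> {..n}"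
      and eq: "take i w @ Suc n # drop i w = take i' w' @ Suc n # drop i' w'"
      by (cases P; cases P') auto
    have "Suc n \<notin> set (take i w)" "Suc n \<notin> set (drop i w)"
      using w(1) by (auto simp: words_def dest!: in_set_takeD in_set_dropD)
    then have parts: "take i w = take i' w'" "drop i w = drop i' w'"
      using eq by (simp_all add: append_Cons_eq_iff)
    then have "w = w'" by (metis append_take_drop_id)
    moreover have "i = i'"
      using arg_cong[OF parts(1), of length] w length_words[OF w(1)] length_words[OF w(3)] by simp
    ultimately show "P = P'" using P by simp
  qed
  show "(\<lambda>(w, i). take i w @ Suc n # drop i w) ` (words n \<times> {..n}) = words (Suc n)"
  proof (intro equalityI subsetI)
    fix v assume "v \<in> (\<lambda>(w, i). take i w @ Suc n # drop i w) ` (words n \<times> {..n})"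
    then obtain w i where v: "v = take i w @ Suc n # drop i w" and w: "w \<in> words n" by auto
    have "set v = insert (Suc n) (set (take i w @ drop i w))"
      unfolding v by (simp del: append_take_drop_id)
    moreover have "distinct v \<longleftrightarrow> distinct (Suc n # take i w @ drop i w)"
      unfolding v by (auto simp del: append_take_drop_id)
    ultimately show "v \<in> words (Suc n)"
      using w unfolding append_take_drop_id by (auto simp: words_def)
  next
    fix v assume v: "v \<in> words (Suc n)"
    then have "Suc n \<in> set v" by (simp add: words_def)
    then obtain us vs where v': "v = us @ Suc n # vs" by (meson split_list)
    have "insert (Suc n) (set (us @ vs)) = insert (Suc n) {1..n}" "Suc n \<notin> set (us @ vs)"
      using v unfolding v' words_def by auto
    then have "set (us @ vs) = {1..n}" by (metis atLeastAtMost_iff insert_ident not_less_eq_eq order_refl)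
    then have w: "us @ vs \<in> words n" using v unfolding v' words_def by auto
    moreover have "length us \<le> n" using length_words[OF w] by simp
    ultimately show "v \<in> (\<lambda>(w, i). take i w @ Suc n # drop i w) ` (words n \<times> {..n})"
      unfolding v' by (intro image_eqI[of _ _ "(us @ vs, length us)"]) auto
  qed
qed

section \<open>The recursion for big descents\<close>

definition big_drop :: "nat \<Rightarrow> nat \<Rightarrow> bool" where
  "big_drop u v \<longleftrightarrow> int u - int v \<ge> 2"

lemma big_descents_eq_adjacencies:
  "big_descents n \<sigma> = adjacencies big_drop (map \<sigma> [1..<n + 1])"
  by (auto simp: big_descents_def adjacencies_def big_drop_def simp del: upt_Suc)

text \<open>Placing \<open>Suc n\<close> before a letter creates a big drop unless that letter is
  \<open>n\<close>. So the neutral slots are the big descents, the slot \<open>m\<close> just before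
  \<open>n\<close>, and the end slot \<open>n\<close>.\<close>

lemma sum_big_descents_insert:
  assumes w: "w \<in> words n" and n: "n \<ge> 1"
  shows "(\<Sum>i\<le>n. f (card (adjacencies big_drop (take i w @ Suc n # drop i w)))) =
    insertion_step n f (card (adjacencies big_drop w))"
proof -
  let ?D = "adjacencies big_drop w"
  let ?d = "card ?D"
  have set: "set w = {1..n}" and dist: "distinct w" and len: "length w = n"
    using w length_words[OF w] by (auto simp: words_def)
  obtain m where m: "m < n" "w ! m = n"
    using n set len by (metis atLeastAtMost_iff in_set_conv_nth order_refl)
  have top: "\<not> big_drop u (Suc n)" "\<not> big_drop u n" "big_drop (Suc n) u \<longleftrightarrow> u \<noteq> n"
    if "u \<in> set w" for u using that set by (auto simp: big_drop_def)
  \<comment> \<open>No letter of \<open>w\<close> exceeds \<open>n\<close>, so \<open>n\<close> is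
    never the lower end of a big drop; the three kinds of neutral slots are thus disjoint.\<close>
  have mD: "m \<notin> ?D"
    using m len top(2)[of "w ! (m - 1)"] by (auto simp: adjacencies_def)
  have nD: "n \<notin> ?D" using len by (simp add: adjacencies_def)
  have drop: "big_drop (Suc n) (w ! i) \<longleftrightarrow> i \<noteq> m" if "i < n" for i
    using that top(3)[of "w ! i"] len m nth_eq_iff_index_eq[OF dist, of i m] by auto
  have "(\<Sum>i\<le>n. f (card (adjacencies big_drop (take i w @ Suc n # drop i w)))) =
      (\<Sum>i\<le>n. if i \<in> insert n (insert m ?D) then f ?d else f (?d + 1))"
  proof (rule sum.cong[OF refl])
    fix i assume "i \<in> {..n}"
    then have i: "i \<le> n" by simp
    have "big_drop (Suc n) (w ! i)" if "i \<in> ?D"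
      using that drop[of i] mD len by (auto simp: adjacencies_def)
    then have "card (adjacencies big_drop (take i w @ Suc n # drop i w)) =
        ?d + (if i < length w \<and> big_drop (Suc n) (w ! i) \<and> i \<notin> ?D then 1 else 0)"
      using i top(1) len by (intro card_adjacencies_insert) auto
    then show "f (card (adjacencies big_drop (take i w @ Suc n # drop i w))) =
        (if i \<in> insert n (insert m ?D) then f ?d else f (?d + 1))"
      using i len drop[of i] by auto
  qed
  also have "\<dots> = card (insert n (insert m ?D)) * f ?d +
      (card {..n} - card (insert n (insert m ?D))) * f (?d + 1)"
    using m len by (intro sum_if_mem) (auto simp: adjacencies_def)
  also have "card (insert n (insert m ?D)) = ?d + 2"
    using mD nD m by simp
  finally show ?thesis by (simp add: insertion_step_def)
qed

lemma sum_big_descents_Suc: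
  assumes n: "n \<ge> 1"
  shows "(\<Sum>\<sigma> | \<sigma> permutes {1..Suc n}. f (card (big_descents (Suc n) \<sigma>))) =
    (\<Sum>\<sigma> | \<sigma> permutes {1..n}. insertion_step n f (card (big_descents n \<sigma>)))"
proof -
  \<comment> \<open>Kept general in \<open>m\<close> and \<open>g\<close>, since it serves both for
    \<open>f\<close> at \<open>Suc n\<close> and for \<open>insertion_step n f\<close> at
    \<open>n\<close>.\<close>
  have one: "(\<Sum>\<sigma> | \<sigma> permutes {1..m}. g (card (big_descents m \<sigma>))) =
      (\<Sum>w\<in>words m. g (card (adjacencies big_drop w)))" for m and g :: "nat \<Rightarrow> nat"
    unfolding big_descents_eq_adjacencies by (rule sum.reindex_bij_betw[OF bij_betw_one_line])
  have "(\<Sum>v\<in>words (Suc n). f (card (adjacencies big_drop v))) =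
      (\<Sum>(w, i)\<in>words n \<times> {..n}. f (card (adjacencies big_drop (take i w @ Suc n # drop i w))))"
    by (subst sum.reindex_bij_betw[OF bij_betw_insert_words, symmetric]) (simp add: case_prod_unfold)
  also have "\<dots> = (\<Sum>w\<in>words n. \<Sum>i\<le>n. f (card (adjacencies big_drop (take i w @ Suc n # drop i w))))"
    by (rule sum.cartesian_product[symmetric])
  also have "\<dots> = (\<Sum>w\<in>words n. insertion_step n f (card (adjacencies big_drop w)))"
    using n by (intro sum.cong refl sum_big_descents_insert)
  finally show ?thesis unfolding one .
qed

section \<open>Equidistribution\<close>

text \<open>The test function must vary in the induction: both sums for \<open>f\<close> at
  \<open>Suc n\<close> are sums for \<open>insertion_step n f\<close> at \<open>n\<close>. The
  induction starts at 1 because the count \<open>s + 2\<close> presupposes a nonempty word.\<close>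

lemma sum_descents_eq_sum_big_descents:
  fixes f :: "nat \<Rightarrow> nat"
  assumes "n \<ge> 1"
  shows "(\<Sum>\<pi> | \<pi> permutes {1..n}. f (card (descents (flatten n \<pi>)))) =
    (\<Sum>\<sigma> | \<sigma> permutes {1..n}. f (card (big_descents n \<sigma>)))"
  using assms
proof (induction n arbitrary: f rule: nat_induct_at_least)
  case base
  have "descents (flatten 1 \<pi>) = {}" if "\<pi> permutes {1..1}" for \<pi>
    using distinct_card[OF distinct_flatten[OF that]] set_flatten[OF that] by (simp add: descents_def)
  moreover have "big_descents 1 \<pi> = {}" for \<pi> by (simp add: big_descents_def)
  ultimately show ?case by (intro sum.cong refl) (simp only: mem_Collect_eq)
next
  case (Suc n)
  show ?case
    unfolding sum_descents_flatten_Suc[OF Suc.hyps, of f] sum_big_descents_Suc[OF Suc.hyps, of f]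
    by (rule Suc.IH)
qed

theorem theorem2p5:
  fixes n k :: nat
  assumes "n \<ge> 1"
  shows "card {\<pi>. \<pi> permutes {1..n} \<and> card (descents (flatten n \<pi>)) = k} =
         card {\<sigma>. \<sigma> permutes {1..n} \<and> card (big_descents n \<sigma>) = k}"
proof -
  \<comment> \<open>A cardinality is the sum of an indicator, so the indicator of \<open>k\<close>
    serves as test function.\<close>
  have "card {p. p permutes {1..n} \<and> g p = k} = (\<Sum>p | p permutes {1..n}. of_bool (g p = k))"
    for g :: "(nat \<Rightarrow> nat) \<Rightarrow> nat"
    by (simp add: sum.If_cases of_bool_def finite_permutations Collect_conj_eq)
  then show ?thesis
    using sum_descents_eq_sum_big_descents[OF assms, of "\<lambda>s. of_bool (s = k)"] by simp
qed

end
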